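(* Let $(P_g^*,\lambda^*,\mu^* )\in\mathbb R^n\times\mathbb R\times\mathbb R^n$ be the unique primal-dual optimizer of the economic dispatch problem $$\text{minimize } C(P_g)\quad\text{subject to}\quad \mathbf 1^TP_g=\mathbf 1^TP_d,\quad P_g\ge 0,$$ that is, $(P_g^*,\lambda^*,\mu^* )$ satisfies the Karush-Kuhn-Tucker conditions $$\nabla C(P_g^* )=\mathbf 1\lambda^*+\mu^*,\qquad \mathbf 1^TP_g^*=\mathbf 1^TP_d,\qquad P_g^*\ge0,\ \ \mu^*\ge 0,\ \ (P_g^* )^T\mu^*=0 .$$ Suppose that $P_{gi}^*>0$ for at least two distinct $i\in\{1,\dots,n\}$. Then any $b^*\in\mathbb R^n_{\ge0}$ satisfying $\mathbf 1\lambda^*\le b^*\le\nabla C(P_g^* )$ (componentwise) is an efficient Nash equilibrium of the inelastic electricity market game.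
   Context: Let $n\in\mathbb N$; vector inequalities are componentwise and $\mathbf 1\in\mathbb R^n$ is the all-ones vector. For each generator $i\in\{1,\dots,n\}$, $C_i:\mathbb R_{\ge0}\to\mathbb R_{\ge0}$ is a cost function that is strongly convex on $\mathbb R_{\ge0}$ (twice continuously differentiable, with $\nabla^2C_i(x)>\mu_i$ for all $x\ge0$ and some constant $\mu_i>0$) and satisfies $\nabla C_i(0)\ge0$. Put $C(P_g)=\sum_{i=1}^nC_i(P_{gi})$ for $P_g\in\mathbb R^n_{\ge0}$. The load vector $P_d\in\mathbb R^n_{\ge0}$ satisfies $\mathbf 1^TP_d>0$. Given a bid vector $b\in\mathbb R^n_{\ge0}$, the independent system operator (ISO) solves the linear problem $$\mathrm{(LP}_b)\qquad \text{minimize } b^TP_g\quad\text{subject to}\quad \mathbf 1^TP_g=\mathbf 1^TP_d,\quad P_g\ge0,$$ which may have several optimizers; $P_g^{\rm opt}(b)$ denotes an optimizer of $(\mathrm{LP}_b)$, with $i$-th component $P_{gi}^{\rm opt}(b)$. Inelastic electricity market game: the players are the generators $\{1,\dots,n\}$; the action of player $i$ is a bid $b_i\in\mathbb R_{\ge0}$; the payoff of player $i$ is $$\Pi_i(b_i,P_{gi}^{\rm opt}(b))=P_{gi}^{\rm opt}(b)\,b_i-C_i(P_{gi}^{\rm opt}(b)).$$ Write $b=(b_i,b_{-i})$, where $b_{-i}$ collects the bids of all players except $i$. Nash equilibrium: $b^*\in\mathbb R^n_{\ge0}$ is a Nash equilibrium of the game if there exists an optimizer $P_g^{\rm opt}(b^*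 )$ of $(\mathrm{LP}_{b^*})$ such that for each $i\in\{1,\dots,n\}$, $$\Pi_i(b_i,P_{gi}^{\rm opt}(b_i,b_{-i}^* ))\le\Pi_i(b_i^*,P_{gi}^{\rm opt}(b^* ))$$ for all $b_i\in\mathbb R_{\ge0}$ with $b_i\ne b_i^*$ and all optimizers $P_g^{\rm opt}(b_i,b_{-i}^* )$ of $(\mathrm{LP}_b)$ with $b=(b_i,b_{-i}^* )$. Efficient bid: $b^*\in\mathbb R^n_{\ge0}$ is an efficient bid if the optimizer $P_g^*$ of the economic dispatch problem is also an optimizer of $(\mathrm{LP}_{b^*})$ and $P_{gi}^*=\operatorname{arg\,max}_{P_{gi}\ge0}\{P_{gi}b_i^*-C_i(P_{gi})\}$ for each $i\in\{1,\dots,n\}$. Efficient Nash equilibrium: a bid $b^*\in\mathbb R^n_{\ge0}$ that is both an efficient bid and a Nash equilibrium. *)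

theory Defs
  imports "HOL-Analysis.Analysis"
begin

(* Derivative relative to the nonnegative half-line: cost functions only matter on {0..},
   so at 0 this is the right derivative. *)
definition nabla :: "(real \<Rightarrow> real) \<Rightarrow> real \<Rightarrow> real" where
  "nabla f x = vector_derivative f (at x within {0..})"

definition twice_cont_diff_nonneg :: "(real \<Rightarrow> real) \<Rightarrow> bool" where
  "twice_cont_diff_nonneg f \<longleftrightarrow>
     f differentiable_on {0..} \<and>
     nabla f differentiable_on {0..} \<and>
     continuous_on {0..} (nabla (nabla f))"

definition strongly_convex_nonneg :: "(real \<Rightarrow> real) \<Rightarrow> bool" where
  "strongly_convex_nonneg f \<longleftrightarrow>
     twice_cont_diff_nonneg f \<and> (\<exists>m>0. \<forall>x\<ge>0. nabla (nabla f) x > m)"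

definition cost_function :: "(real \<Rightarrow> real) \<Rightarrow> bool" where
  "cost_function f \<longleftrightarrow>
     (\<forall>x\<ge>0. f x \<ge> 0) \<and> strongly_convex_nonneg f \<and> nabla f 0 \<ge> 0"

definition vec_upd :: "real ^ 'n \<Rightarrow> 'n \<Rightarrow> real \<Rightarrow> real ^ 'n" where
  "vec_upd v i t = (\<chi> j. if j = i then t else v $ j)"

definition total_cost :: "('n::finite \<Rightarrow> real \<Rightarrow> real) \<Rightarrow> real ^ 'n \<Rightarrow> real" where
  "total_cost C P = (\<Sum>i\<in>UNIV. C i (P $ i))"

(* Gradient on the nonnegative orthant: the vector of partial derivatives, each taken
   relative to {0..}. *)
definition grad :: "(real ^ 'n \<Rightarrow> real) \<Rightarrow> real ^ 'n \<Rightarrow> real ^ 'n" where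
  "grad F P = (\<chi> i. nabla (\<lambda>t. F (vec_upd P i t)) (P $ i))"

definition feasible :: "real ^ 'n::finite \<Rightarrow> real ^ 'n \<Rightarrow> bool" where
  "feasible Pd P \<longleftrightarrow> 1 \<bullet> P = 1 \<bullet> Pd \<and> 0 \<le> P"

definition ed_optimizer ::
  "('n::finite \<Rightarrow> real \<Rightarrow> real) \<Rightarrow> real ^ 'n \<Rightarrow> real ^ 'n \<Rightarrow> bool" where
  "ed_optimizer C Pd P \<longleftrightarrow> is_arg_min (total_cost C) (feasible Pd) P"

definition ed_KKT ::
  "('n::finite \<Rightarrow> real \<Rightarrow> real) \<Rightarrow> real ^ 'n \<Rightarrow> real ^ 'n \<Rightarrow> real \<Rightarrow> real ^ 'n \<Rightarrow> bool" where
  "ed_KKT C Pd P l m \<longleftrightarrow>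
     grad (total_cost C) P = vec l + m \<and>
     1 \<bullet> P = 1 \<bullet> Pd \<and> 0 \<le> P \<and> 0 \<le> m \<and> P \<bullet> m = 0"

definition lp_optimizer :: "real ^ 'n::finite \<Rightarrow> real ^ 'n \<Rightarrow> real ^ 'n \<Rightarrow> bool" where
  "lp_optimizer Pd b P \<longleftrightarrow> is_arg_min (\<lambda>P. b \<bullet> P) (feasible Pd) P"

definition payoff :: "('n \<Rightarrow> real \<Rightarrow> real) \<Rightarrow> 'n \<Rightarrow> real \<Rightarrow> real \<Rightarrow> real" where
  "payoff C i \<beta> p = p * \<beta> - C i p"

definition nash_equilibrium ::
  "('n::finite \<Rightarrow> real \<Rightarrow> real) \<Rightarrow> real ^ 'n \<Rightarrow> real ^ 'n \<Rightarrow> bool" where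
  "nash_equilibrium C Pd b \<longleftrightarrow>
     0 \<le> b \<and>
     (\<exists>P. lp_optimizer Pd b P \<and>
        (\<forall>i \<beta> Q. 0 \<le> \<beta> \<longrightarrow> \<beta> \<noteq> b $ i \<longrightarrow> lp_optimizer Pd (vec_upd b i \<beta>) Q \<longrightarrow>
           payoff C i \<beta> (Q $ i) \<le> payoff C i (b $ i) (P $ i)))"

(* "The optimizer" and "P = arg max" are read with uniqueness, hence the singleton sets. *)
definition efficient_bid ::
  "('n::finite \<Rightarrow> real \<Rightarrow> real) \<Rightarrow> real ^ 'n \<Rightarrow> real ^ 'n \<Rightarrow> bool" where
  "efficient_bid C Pd b \<longleftrightarrow>
     0 \<le> b \<and>
     (\<exists>P. {P'. ed_optimizer C Pd P'} = {P} \<and>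
        lp_optimizer Pd b P \<and>
        (\<forall>i. {p. is_arg_max (\<lambda>p. p * b $ i - C i p) (\<lambda>p. 0 \<le> p) p} = {P $ i}))"

definition efficient_nash_equilibrium ::
  "('n::finite \<Rightarrow> real \<Rightarrow> real) \<Rightarrow> real ^ 'n \<Rightarrow> real ^ 'n \<Rightarrow> bool" where
  "efficient_nash_equilibrium C Pd b \<longleftrightarrow> efficient_bid C Pd b \<and> nash_equilibrium C Pd b"

lemma nabla_eqI:
  assumes "(f has_vector_derivative D) (at x within {0..})" "0 \<le> x"
  shows "nabla f x = D"
proof -
  have "at_right x \<le> at x within {0..}"
    using assms(2) by (intro at_le) auto
  then have "at x within {0..} \<noteq> bot"
    using trivial_limit_at_right_real[of x] by (metis bot.extremum_uniqueI)
  then show ?thesis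
    unfolding nabla_def using assms(1) by (rule vector_derivative_within)
qed

lemma grad_total_cost:
  assumes "\<And>i. cost_function (C i)" "0 \<le> P"
  shows "grad (total_cost C) P = (\<chi> i. nabla (C i) (P $ i))"
proof -
  have "nabla (\<lambda>t. total_cost C (vec_upd P i t)) (P $ i) = nabla (C i) (P $ i)" for i
  proof (rule nabla_eqI)
    show nn: "0 \<le> P $ i" using assms(2) by (simp add: less_eq_vec_def)
    have "C i differentiable (at (P $ i) within {0..})"
      using assms(1)[of i] nn
      by (auto simp: cost_function_def strongly_convex_nonneg_def twice_cont_diff_nonneg_def
          differentiable_on_def)
    then have D: "(C i has_vector_derivative nabla (C i) (P $ i)) (at (P $ i) within {0..})"
      by (simp add: nabla_def vector_derivative_works)
    have "total_cost C (vec_upd P i t) = C i t + (\<Sum>j\<in>UNIV - {i}. C j (P $ j))" for t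
      unfolding total_cost_def vec_upd_def by (simp add: sum.remove[where x = i])
    then show "((\<lambda>t. total_cost C (vec_upd P i t)) has_vector_derivative nabla (C i) (P $ i))
        (at (P $ i) within {0..})"
      using has_vector_derivative_add[OF D has_vector_derivative_const] by simp
  qed
  then show ?thesis by (simp add: grad_def)
qed

end

theory Submission
  imports Defs
begin

text \<open>
  Write \<open>P\<close>, \<open>l\<close>, \<open>b\<close> for the dispatch, the price and the bid. Complementary slackness and the
  two bounds on \<open>b\<close> leave a generator no choice when it is active: if \<open>P $ i > 0\<close>, then
  \<open>b $ i = l = nabla (C i) (P $ i)\<close>; if \<open>P $ i = 0\<close>, then
  \<open>l \<le> b $ i \<le> nabla (C i) 0\<close>. In both cases \<open>b $ i\<close> is a subgradient of the
  strictly convex function \<open>C i\<close>, restricted to the half-line, at \<open>P $ i\<close>, so \<open>P $ i\<close> is the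
  unique production level that maximizes the profit at price \<open>b $ i\<close>
  (\<open>profit_maximizer_of_bid\<close>).

  The price \<open>l\<close> is the lowest bid and only generators that bid \<open>l\<close> produce in \<open>P\<close>, so \<open>P\<close>
  solves the linear problem of the operator (\<open>lp_optimizer_of_price\<close>). Summing the profit
  inequalities over all generators and comparing \<open>b \<bullet> Q\<close> with \<open>b \<bullet> P\<close> shows
  that \<open>P\<close> is also the unique economic dispatch (\<open>ed_optimizer_of_profit_maximizers\<close>). Hence \<open>b\<close> is efficient.

  For the equilibrium property, suppose that generator \<open>i\<close> deviates to \<open>\<beta>\<close>. Because two
  generators are active, some competitor still bids \<open>l\<close>. If \<open>\<beta> > l\<close>, the operator
  therefore gives nothing to \<open>i\<close> (\<open>lp_optimizer_overbid_zero\<close>), and producing nothing is no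
  better than \<open>P $ i\<close> at the price \<open>b $ i\<close>. If \<open>\<beta> \<le> l \<le> b $ i\<close>, whatever amount
  \<open>i\<close> is assigned would have earned at least as much at the price \<open>b $ i\<close>, and there
  \<open>P $ i\<close> is optimal.
\<close>

section \<open>Strict convexity of the cost functions on the half-line\<close>

lemma nonneg_mean_value:
  fixes f :: "real \<Rightarrow> real"
  assumes "f differentiable_on {0..}" and "0 \<le> x" and "x < y"
  obtains z where "x < z" "z < y" "f y - f x = nabla f z * (y - x)"
proof -
  have "(f has_derivative (\<lambda>h. h *\<^sub>R nabla f t)) (at t within {x..y})"
    if "x \<le> t" "t \<le> y" for t
  proof -
    have "f differentiable (at t within {0..})"
      using assms(1,2) that by (auto simp: differentiable_on_def)
    then have "(f has_vector_derivative nabla f t) (at t within {0..})"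
      by (simp add: nabla_def vector_derivative_works)
    then have "(f has_vector_derivative nabla f t) (at t within {x..y})"
      by (rule has_vector_derivative_within_subset) (use assms(2) in auto)
    then show ?thesis
      by (simp add: has_vector_derivative_def)
  qed
  from mvt_simple[OF assms(3) this] show thesis
    using that by (auto simp: mult.commute)
qed

lemma nabla_strict_mono:
  assumes "strongly_convex_nonneg f" and "0 \<le> x" and "x < y"
  shows "nabla f x < nabla f y"
proof -
  have "nabla f differentiable_on {0..}"
    using assms(1) by (simp add: strongly_convex_nonneg_def twice_cont_diff_nonneg_def)
  from nonneg_mean_value[OF this assms(2,3)] obtain z
    where z: "x < z" "nabla f y - nabla f x = nabla (nabla f) z * (y - x)"
    by metis
  obtain m where m: "m > 0" "\<forall>t\<ge>0. nabla (nabla f) t > m"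
    using assms(1) unfolding strongly_convex_nonneg_def by blast
  have "0 \<le> z"
    using z(1) assms(2) by linarith
  then have "nabla (nabla f) z > m"
    using m(2) by blast
  then have "nabla (nabla f) z * (y - x) > 0"
    using m(1) assms(3) by simp
  then show ?thesis
    using z(2) by simp
qed

lemma strict_tangent_inequality:
  assumes "strongly_convex_nonneg f" and "0 \<le> x" and "0 \<le> y" and "x \<noteq> y"
  shows "f x + nabla f x * (y - x) < f y"
proof -
  have d: "f differentiable_on {0..}"
    using assms(1) by (simp add: strongly_convex_nonneg_def twice_cont_diff_nonneg_def)
  consider "x < y" | "y < x"
    using assms(4) by linarith
  then show ?thesis
  proof cases
    case 1
    obtain z where z: "x < z" "f y - f x = nabla f z * (y - x)"
      using nonneg_mean_value[OF d assms(2) 1] by metis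
    have "nabla f x < nabla f z"
      using nabla_strict_mono[OF assms(1,2) z(1)] .
    then have "nabla f x * (y - x) < nabla f z * (y - x)"
      using 1 by simp
    then show ?thesis
      using z(2) by linarith
  next
    case 2
    obtain z where z: "y < z" "z < x" "f x - f y = nabla f z * (x - y)"
      using nonneg_mean_value[OF d assms(3) 2] by metis
    have "nabla f z < nabla f x"
      using nabla_strict_mono[OF assms(1) _ z(2)] z(1) assms(3) by simp
    then have "nabla f z * (x - y) < nabla f x * (x - y)"
      using 2 by simp
    moreover have "nabla f x * (y - x) = - (nabla f x * (x - y))"
      by (simp add: algebra_simps)
    ultimately show ?thesis
      using z(3) by linarith
  qed
qed

text \<open>
  The hypotheses on \<open>\<beta>\<close> say that it is a subgradient at \<open>x\<close> of \<open>f\<close> restricted to the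
  half-line: at an interior point this is the derivative, while at \<open>0\<close> any smaller slope is
  admissible as well.
\<close>

lemma profit_maximizer_of_bid:
  assumes "strongly_convex_nonneg f" and "0 \<le> x" and "0 \<le> y" and "x \<noteq> y"
    and "\<beta> \<le> nabla f x" and "0 < x \<Longrightarrow> \<beta> = nabla f x"
  shows "y * \<beta> - f y < x * \<beta> - f x"
proof -
  have "\<beta> * (y - x) \<le> nabla f x * (y - x)"
  proof (cases "0 < x")
    case False
    then have "0 \<le> y - x"
      using assms(2,3) by simp
    then show ?thesis
      using assms(5) by (rule mult_right_mono[rotated])
  qed (simp add: assms(6))
  then show ?thesis
    using strict_tangent_inequality[OF assms(1-4)] by (simp add: algebra_simps)
qed

section \<open>The linear problem of the operator\<close>

lemma one_inner_eq_sum: "1 \<bullet> (v :: real ^ 'n::finite) = (\<Sum>i\<in>UNIV. v $ i)"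
  by (simp add: inner_vec_def)

text \<open>
  This is weak duality: \<open>l\<close> times the load bounds the value of every feasible point from below, and
  a point that uses only generators bidding \<open>l\<close> attains the bound.
\<close>

lemma lp_optimizer_of_price:
  fixes P b Pd :: "real ^ 'n::finite"
  assumes "feasible Pd P" and "\<And>i. l \<le> b $ i" and "\<And>i. 0 < P $ i \<Longrightarrow> b $ i = l"
  shows "lp_optimizer Pd b P"
proof -
  have P0: "0 \<le> P $ i" for i
    using assms(1) by (simp add: feasible_def less_eq_vec_def)
  have P_eq: "b $ i * P $ i = l * P $ i" for i
    using assms(3)[of i] P0[of i] by (cases "P $ i = 0") auto
  have "b \<bullet> P = (\<Sum>i\<in>UNIV. l * P $ i)"
    by (simp add: inner_vec_def P_eq)
  also have "\<dots> = l * (1 \<bullet> Pd)"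
    using assms(1) by (simp add: feasible_def one_inner_eq_sum flip: sum_distrib_left)
  finally have val: "b \<bullet> P = l * (1 \<bullet> Pd)" .
  have "b \<bullet> P \<le> b \<bullet> Q" if "feasible Pd Q" for Q
  proof -
    have "l * (1 \<bullet> Pd) = (\<Sum>i\<in>UNIV. l * Q $ i)"
      using that by (simp add: feasible_def one_inner_eq_sum flip: sum_distrib_left)
    also have "\<dots> \<le> (\<Sum>i\<in>UNIV. b $ i * Q $ i)"
      using that assms(2)
      by (intro sum_mono mult_right_mono) (auto simp: feasible_def less_eq_vec_def)
    also have "\<dots> = b \<bullet> Q"
      by (simp add: inner_vec_def)
    finally show ?thesis
      by (simp only: val)
  qed
  then show ?thesis
    using assms(1) by (fastforce simp: lp_optimizer_def is_arg_min_def)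
qed

text \<open>
  Shifting the production of \<open>i\<close> to a cheaper competitor \<open>j\<close> preserves feasibility and would
  strictly lower the value if \<open>i\<close> produced anything.
\<close>

lemma lp_optimizer_overbid_zero:
  fixes Q b Pd :: "real ^ 'n::finite"
  assumes "lp_optimizer Pd b Q" and "b $ j < b $ i"
  shows "Q $ i = 0"
proof (rule ccontr)
  assume "Q $ i \<noteq> 0"
  have feas: "1 \<bullet> Q = 1 \<bullet> Pd" "\<And>k. 0 \<le> Q $ k"
    using assms(1) by (auto simp: lp_optimizer_def is_arg_min_def feasible_def less_eq_vec_def)
  have pos: "0 < Q $ i"
    using feas(2)[of i] \<open>Q $ i \<noteq> 0\<close> by simp
  define Q' where "Q' = Q + Q $ i *\<^sub>R (axis j 1 - axis i 1)"
  have "1 \<bullet> Q' = 1 \<bullet> Q"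
    by (simp add: Q'_def inner_add_right inner_diff_right inner_axis)
  moreover have "0 \<le> Q' $ k" for k
    using feas(2)[of k] feas(2)[of i] by (auto simp: Q'_def axis_def)
  ultimately have "feasible Pd Q'"
    using feas(1) by (simp add: feasible_def less_eq_vec_def)
  moreover have "b \<bullet> Q' = b \<bullet> Q + Q $ i * (b $ j - b $ i)"
    by (simp add: Q'_def inner_add_right inner_diff_right inner_axis)
  moreover have "Q $ i * (b $ j - b $ i) < 0"
    using pos assms(2) by (simp add: mult_pos_neg)
  ultimately show False
    using assms(1) by (auto simp: lp_optimizer_def is_arg_min_def)
qed

section \<open>From individual profit maximization to the economic dispatch\<close>

text \<open>
  Total cost is what the operator pays minus the total profit; \<open>P\<close> minimizes the former
  and is the only point that maximizes every summand of the latter.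
\<close>

lemma ed_optimizer_of_profit_maximizers:
  fixes C :: "'n::finite \<Rightarrow> real \<Rightarrow> real" and P b Pd :: "real ^ 'n"
  assumes lp: "lp_optimizer Pd b P"
    and profit: "\<And>i y. 0 \<le> y \<Longrightarrow> y \<noteq> P $ i \<Longrightarrow> y * b $ i - C i y < P $ i * b $ i - C i (P $ i)"
  shows "{P'. ed_optimizer C Pd P'} = {P}"
proof -
  have cost_split: "total_cost C Q = b \<bullet> Q - (\<Sum>i\<in>UNIV. Q $ i * b $ i - C i (Q $ i))" for Q
    by (simp add: total_cost_def inner_vec_def sum_subtractf mult.commute)
  have feas: "feasible Pd P"
    using lp by (simp add: lp_optimizer_def is_arg_min_def)
  have less: "total_cost C P < total_cost C Q" if Q: "feasible Pd Q" "Q \<noteq> P" for Q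
  proof -
    have Q0: "0 \<le> Q $ i" for i
      using Q(1) by (simp add: feasible_def less_eq_vec_def)
    obtain k where k: "Q $ k \<noteq> P $ k"
      using Q(2) by (auto simp: vec_eq_iff)
    have "Q $ i * b $ i - C i (Q $ i) \<le> P $ i * b $ i - C i (P $ i)" for i
      using profit[OF Q0, of i i] by (cases "Q $ i = P $ i") (auto intro: less_imp_le)
    then have "(\<Sum>i\<in>UNIV. Q $ i * b $ i - C i (Q $ i)) < (\<Sum>i\<in>UNIV. P $ i * b $ i - C i (P $ i))"
      using profit[OF Q0 k] by (intro sum_strict_mono_ex1) auto
    moreover have "b \<bullet> P \<le> b \<bullet> Q"
      using lp Q(1) by (auto simp: lp_optimizer_def is_arg_min_def not_less)
    ultimately show ?thesis
      by (simp add: cost_split)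
  qed
  show ?thesis
  proof (intro equalityI subsetI)
    fix Q assume "Q \<in> {P'. ed_optimizer C Pd P'}"
    then show "Q \<in> {P}"
      using less[of Q] feas by (auto simp: ed_optimizer_def is_arg_min_def)
  next
    fix Q assume "Q \<in> {P}"
    moreover have "\<not> total_cost C Q' < total_cost C P" if "feasible Pd Q'" for Q'
      using less[OF that] by (cases "Q' = P") auto
    ultimately show "Q \<in> {P'. ed_optimizer C Pd P'}"
      using feas by (auto simp: ed_optimizer_def is_arg_min_def)
  qed
qed

section \<open>Efficient Nash equilibria\<close>

theorem mainTheorem1:
  fixes C :: "'n::finite \<Rightarrow> real \<Rightarrow> real"
    and Pd Pstar mstar bstar :: "real ^ 'n"
    and lstar :: real
  assumes cost: "\<And>i. cost_function (C i)"
    and load_nonneg: "0 \<le> Pd"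
    and load_pos: "1 \<bullet> Pd > 0"
    and kkt: "ed_KKT C Pd Pstar lstar mstar"
    and two_active: "\<exists>i j. i \<noteq> j \<and> Pstar $ i > 0 \<and> Pstar $ j > 0"
    and bid_nonneg: "0 \<le> bstar"
    and bid_lower: "vec lstar \<le> bstar"
    and bid_upper: "bstar \<le> grad (total_cost C) Pstar"
  shows "efficient_nash_equilibrium C Pd bstar"
proof -
  have convex: "strongly_convex_nonneg (C i)" for i
    using cost[of i] by (simp add: cost_function_def)
  have P_nonneg: "0 \<le> Pstar" and feas: "feasible Pd Pstar"
    using kkt by (auto simp: ed_KKT_def feasible_def)
  then have P0: "0 \<le> Pstar $ i" for i
    by (simp add: less_eq_vec_def)
  have grad_eq: "grad (total_cost C) Pstar = (\<chi> i. nabla (C i) (Pstar $ i))"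
    using grad_total_cost[of C Pstar] cost P_nonneg by blast
  have lower: "lstar \<le> bstar $ i" for i
    using bid_lower by (simp add: less_eq_vec_def)
  have upper: "bstar $ i \<le> nabla (C i) (Pstar $ i)" for i
    using bid_upper by (simp add: grad_eq less_eq_vec_def)
  have stationary: "nabla (C i) (Pstar $ i) = lstar + mstar $ i" for i
    using kkt by (simp add: ed_KKT_def grad_eq vec_eq_iff)
  have m0: "0 \<le> mstar $ i" for i
    using kkt by (simp add: ed_KKT_def less_eq_vec_def)
  have "(\<Sum>i\<in>UNIV. Pstar $ i * mstar $ i) = 0"
    using kkt by (simp add: ed_KKT_def inner_vec_def)
  then have slack: "Pstar $ i * mstar $ i = 0" for i
    using P0 m0 by (simp add: sum_nonneg_eq_0_iff)
  have active: "nabla (C i) (Pstar $ i) = lstar \<and> bstar $ i = lstar" if "0 < Pstar $ i" for i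
    using slack[of i] stationary[of i] lower[of i] upper[of i] that by simp

  have profit: "y * bstar $ i - C i y < Pstar $ i * bstar $ i - C i (Pstar $ i)"
    if "0 \<le> y" "y \<noteq> Pstar $ i" for i y
    using profit_maximizer_of_bid[OF convex P0 that(1) _ upper] active[of i] that(2) by force
  then have profit_le: "y * bstar $ i - C i y \<le> Pstar $ i * bstar $ i - C i (Pstar $ i)"
    if "0 \<le> y" for i y
    using that by (cases "y = Pstar $ i") (auto intro: less_imp_le)
  have lp: "lp_optimizer Pd bstar Pstar"
    using lp_optimizer_of_price[OF feas lower] active by blast

  have "{p. is_arg_max (\<lambda>p. p * bstar $ i - C i p) (\<lambda>p. 0 \<le> p) p} = {Pstar $ i}" for i
    using profit[of _ i] profit_le[of _ i] P0[of i]
    by (fastforce simp: is_arg_max_def not_less)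
  then have "efficient_bid C Pd bstar"
    using bid_nonneg lp ed_optimizer_of_profit_maximizers[OF lp profit]
    unfolding efficient_bid_def by blast

  moreover have "payoff C i \<beta> (Q $ i) \<le> payoff C i (bstar $ i) (Pstar $ i)"
    if Q: "lp_optimizer Pd (vec_upd bstar i \<beta>) Q" for i \<beta> Q
  proof -
    have Q0: "0 \<le> Q $ i"
      using Q by (simp add: lp_optimizer_def is_arg_min_def feasible_def less_eq_vec_def)
    have "Q $ i * \<beta> \<le> Q $ i * bstar $ i"
    proof (cases "\<beta> \<le> lstar")
      case True
      then show ?thesis
        using lower[of i] Q0 by (intro mult_left_mono) auto
    next
      case False
      obtain j where "j \<noteq> i" "0 < Pstar $ j"
        using two_active by metis
      then have "vec_upd bstar i \<beta> $ j < vec_upd bstar i \<beta> $ i"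
        using active[of j] False by (simp add: vec_upd_def)
      from lp_optimizer_overbid_zero[OF Q this] show ?thesis
        by simp
    qed
    then show ?thesis
      using profit_le[OF Q0] unfolding payoff_def by (rule order.trans[OF diff_right_mono])
  qed
  then have "nash_equilibrium C Pd bstar"
    using bid_nonneg lp unfolding nash_equilibrium_def by blast
  ultimately show ?thesis
    by (simp add: efficient_nash_equilibrium_def)
qed

end
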